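(* Let $K$ be an infinite zero-dimensional Hausdorff compact space. Then \[\operatorname{Lip}_0(C(K))\stackrel{c}{\hookrightarrow}\left(\bigoplus_{\operatorname{w}(K)}\operatorname{Lip}_0(c_0)\right)_{\ell_\infty},\] where the right-hand side is the $\ell_\infty$-sum of $\operatorname{w}(K)$ copies of $\operatorname{Lip}_0(c_0)$.
   Context: $C(K)$ is the space of real continuous functions on $K$ with sup norm; $c_0$ is the space of real null sequences with sup norm. $\operatorname{w}(K)$ is the weight of $K$. $\operatorname{Lip}_0(X)$ is the Banach space of real Lipschitz functions on the Banach space $X$ vanishing at $0$, normed by the smallest Lipschitz constant. $\left(\bigoplus_{j\in\varGamma}Z_j\right)_{\ell_\infty}$ is the space of bounded families $(z_j)$ with the sup norm. $X\stackrel{c}{\hookrightarrow}Y$ means $Y$ contains a complemented subspace isomorphic to $X$. *)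

theory Defs
  imports "HOL-Analysis.Analysis" "HOL-Library.Equipollence" "HOL-Library.Function_Algebras"
begin

instantiation "fun" :: (type, real_vector) real_vector
begin
definition scaleR_fun :: "real \<Rightarrow> ('a \<Rightarrow> 'b) \<Rightarrow> 'a \<Rightarrow> 'b" where
  "scaleR_fun c f = (\<lambda>x. c *\<^sub>R f x)"
instance
  by standard (auto simp: scaleR_fun_def fun_eq_iff scaleR_add_right scaleR_add_left)
end

text \<open>Concrete normed spaces are represented by a carrier set V (a linear subspace of a
  real vector space type) together with a norm function N defined on V.\<close>

text \<open>C(K) for a compact Hausdorff space K given as a topological type: all continuous
  real functions (all bounded, since K is compact), with the sup norm.\<close>
definition CK :: "('a::topological_space \<Rightarrow> real) set" where
  "CK = {f. continuous_on UNIV f}"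

definition CK_norm :: "('a::topological_space \<Rightarrow> real) \<Rightarrow> real" where
  "CK_norm f = (SUP x. \<bar>f x\<bar>)"

definition c0 :: "(nat \<Rightarrow> real) set" where
  "c0 = {x. x \<longlonglongrightarrow> 0}"

definition c0_norm :: "(nat \<Rightarrow> real) \<Rightarrow> real" where
  "c0_norm x = (SUP n. \<bar>x n\<bar>)"

text \<open>Lip_0(X): real Lipschitz functions on X vanishing at 0 (taken to be 0 outside the
  carrier, so that the carrier is a genuine vector space of functions), normed by the smallest
  Lipschitz constant.\<close>
definition Lip0 :: "'v::real_vector set \<Rightarrow> ('v \<Rightarrow> real) \<Rightarrow> ('v \<Rightarrow> real) set" where
  "Lip0 V N = {f. f 0 = 0 \<and> (\<forall>x. x \<notin> V \<longrightarrow> f x = 0) \<and>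
      (\<exists>C. \<forall>x\<in>V. \<forall>y\<in>V. \<bar>f x - f y\<bar> \<le> C * N (x - y))}"

definition Lip0_norm :: "'v::real_vector set \<Rightarrow> ('v \<Rightarrow> real) \<Rightarrow> ('v \<Rightarrow> real) \<Rightarrow> real" where
  "Lip0_norm V N f = Inf {C. 0 \<le> C \<and> (\<forall>x\<in>V. \<forall>y\<in>V. \<bar>f x - f y\<bar> \<le> C * N (x - y))}"

definition linf_sum :: "'i set \<Rightarrow> 'v::real_vector set \<Rightarrow> ('v \<Rightarrow> real) \<Rightarrow> ('i \<Rightarrow> 'v) set" where
  "linf_sum \<Gamma> V N = {z. (\<forall>j\<in>\<Gamma>. z j \<in> V) \<and> (\<forall>j. j \<notin> \<Gamma> \<longrightarrow> z j = 0) \<and>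
      bdd_above ((\<lambda>j. N (z j)) ` \<Gamma>)}"

definition linf_norm :: "'i set \<Rightarrow> ('v::real_vector \<Rightarrow> real) \<Rightarrow> ('i \<Rightarrow> 'v) \<Rightarrow> real" where
  "linf_norm \<Gamma> N z = (SUP j\<in>\<Gamma>. N (z j))"

definition bdd_lin_op :: "'v::real_vector set \<Rightarrow> ('v \<Rightarrow> real) \<Rightarrow> 'w::real_vector set \<Rightarrow> ('w \<Rightarrow> real)
    \<Rightarrow> ('v \<Rightarrow> 'w) \<Rightarrow> bool" where
  "bdd_lin_op X NX Y NY T \<longleftrightarrow> (\<forall>x\<in>X. T x \<in> Y) \<and>
     (\<forall>x\<in>X. \<forall>y\<in>X. T (x + y) = T x + T y) \<and> (\<forall>c. \<forall>x\<in>X. T (c *\<^sub>R x) = c *\<^sub>R T x) \<and>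
     (\<exists>C. \<forall>x\<in>X. NY (T x) \<le> C * NX x)"

definition lin_subspace :: "'v::real_vector set \<Rightarrow> 'v set \<Rightarrow> bool" where
  "lin_subspace Z Y \<longleftrightarrow> Z \<subseteq> Y \<and> 0 \<in> Z \<and> (\<forall>x\<in>Z. \<forall>y\<in>Z. x + y \<in> Z) \<and> (\<forall>c. \<forall>x\<in>Z. c *\<^sub>R x \<in> Z)"

definition complemented :: "'w::real_vector set \<Rightarrow> 'w set \<Rightarrow> ('w \<Rightarrow> real) \<Rightarrow> bool" where
  "complemented Z Y NY \<longleftrightarrow> lin_subspace Z Y \<and>
     (\<exists>P. bdd_lin_op Y NY Y NY P \<and> P ` Y = Z \<and> (\<forall>z\<in>Z. P z = z))"

definition isomorphic :: "'v::real_vector set \<Rightarrow> ('v \<Rightarrow> real) \<Rightarrow> 'w::real_vector set \<Rightarrow> ('w \<Rightarrow> real)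
    \<Rightarrow> bool" where
  "isomorphic X NX Z NZ \<longleftrightarrow> (\<exists>T. bij_betw T X Z \<and> bdd_lin_op X NX Z NZ T \<and>
      bdd_lin_op Z NZ X NX (inv_into X T))"

definition comp_embeds :: "'v::real_vector set \<Rightarrow> ('v \<Rightarrow> real) \<Rightarrow> 'w::real_vector set \<Rightarrow> ('w \<Rightarrow> real)
    \<Rightarrow> bool" where
  "comp_embeds X NX Y NY \<longleftrightarrow> (\<exists>Z. complemented Z Y NY \<and> isomorphic X NX Z NY)"

text \<open>\<Gamma> has cardinality w(K), the weight (least cardinality of a base) of the space K = 'a.\<close>
definition has_weight_card :: "'a::topological_space itself \<Rightarrow> 'i set \<Rightarrow> bool" where
  "has_weight_card _ \<Gamma> \<longleftrightarrow> (\<exists>B::'a set set. topological_basis B \<and> B \<approx> \<Gamma>) \<and>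
     (\<forall>B::'a set set. topological_basis B \<longrightarrow> \<Gamma> \<lesssim> B)"

end

theory Submission
  imports Defs
begin

text \<open>
  For a finite clopen partition \<open>p = [A\<^sub>1, \<dots>, A\<^sub>n]\<close> of \<open>K\<close> with chosen points \<open>t\<^sub>k \<in> A\<^sub>k\<close>,
  sampling \<open>R\<^sub>p x = (x(t\<^sub>1), \<dots>, x(t\<^sub>n), 0, \<dots>)\<close> maps \<open>C(K)\<close> to \<open>c\<^sub>0\<close> and step functions
  \<open>E\<^sub>p a = \<Sum>\<^sub>k a\<^sub>k 1\<^bsub>A\<^sub>k\<^esub>\<close> map \<open>c\<^sub>0\<close> back to \<open>C(K)\<close>, both with norm at most 1; by compactness
  and zero-dimensionality, \<open>E\<^sub>p R\<^sub>p x \<rightarrow> x\<close> as \<open>p\<close> is refined. There are at most \<open>w(K)\<close> clopen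
  partitions, so they can be indexed by \<open>\<Gamma>\<close>. Then \<open>f \<mapsto> (f \<circ> E\<^bsub>p\<^sub>j\<^esub>)\<^sub>j\<close> maps \<open>Lip\<^sub>0(C(K))\<close> into the
  \<open>\<ell>\<^sub>\<infinity>\<close>-sum with norm at most 1, and \<open>(g\<^sub>j)\<^sub>j \<mapsto> (x \<mapsto> lim\<^sub>U g\<^sub>j(R\<^bsub>p\<^sub>j\<^esub> x))\<close>, for an
  ultrafilter \<open>U\<close> on \<open>\<Gamma>\<close> finer than the filter of refinement, is a left inverse of norm at
  most 1. Their composition is the required projection.
\<close>

section \<open>Ultrafilter limits\<close>

definition is_ultrafilter :: "'a filter \<Rightarrow> bool" where
  "is_ultrafilter U \<longleftrightarrow> U \<noteq> bot \<and> (\<forall>P. eventually P U \<or> eventually (\<lambda>x. \<not> P x) U)"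

lemma maximal_filter_is_ultrafilter:
  assumes "F \<noteq> bot"
    and max: "\<And>G. G \<noteq> bot \<Longrightarrow> G \<le> F \<Longrightarrow> F = G"
  shows "is_ultrafilter F"
  unfolding is_ultrafilter_def
proof (intro conjI allI assms(1))
  fix P
  show "eventually P F \<or> (\<forall>\<^sub>F x in F. \<not> P x)"
  proof (rule disjCI)
    assume "\<not> (\<forall>\<^sub>F x in F. \<not> P x)"
    then have "inf F (principal {x. P x}) \<noteq> bot"
      by (simp add: trivial_limit_def eventually_inf_principal not_eventually)
    then have F: "F = inf F (principal {x. P x})"
      by (rule max) simp
    show "eventually P F"
      by (subst F) (simp add: eventually_inf_principal)
  qed
qed

lemma ultrafilter_exists_le:
  fixes F :: "'a filter"
  assumes F: "F \<noteq> bot"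
  shows "\<exists>U\<le>F. is_ultrafilter U"
proof -
  let ?R = "{(b, a). a \<noteq> bot \<and> a \<le> b \<and> b \<le> F}"
  have bot_notin_chain: "c \<in> Chains ?R \<Longrightarrow> bot \<notin> c" for c
    by (auto simp: Chains_def)
  have [simp]: "Field ?R = {G. G \<noteq> bot \<and> G \<le> F}"
    by (auto simp: Field_def bot_unique)
  have "\<exists>m\<in>Field ?R. \<forall>a\<in>Field ?R. (m, a) \<in> ?R \<longrightarrow> a = m"
  proof (rule Zorns_po_lemma)
    show "Partial_order ?R"
      by (auto simp: partial_order_on_def preorder_on_def
          antisym_def refl_on_def trans_def Field_def bot_unique)
    show "\<exists>u\<in>Field ?R. \<forall>a\<in>C. (a, u) \<in> ?R" if C: "C \<in> Chains ?R" for C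
    proof (simp, intro exI conjI ballI)
      have Inf_C: "Inf C \<noteq> bot" "Inf C \<le> F" if "C \<noteq> {}"
      proof -
        from C that have "Inf C = bot \<longleftrightarrow> (\<exists>x\<in>C. x = bot)"
          unfolding trivial_limit_def by (intro eventually_Inf_base) (auto simp: Chains_def)
        with C show "Inf C \<noteq> bot"
          by (simp add: bot_notin_chain)
        from that obtain x where "x \<in> C" by auto
        with C show "Inf C \<le> F"
          by (auto intro!: Inf_lower2[of x] simp: Chains_def)
      qed
      then have [simp]: "inf F (Inf C) = (if C = {} then F else Inf C)"
        using C by (auto simp add: inf_absorb2)
      from C show "inf F (Inf C) \<noteq> bot"
        by (simp add: F Inf_C)
      from C show "inf F (Inf C) \<le> F"
        by (simp add: Chains_def Inf_C F)
      with C show "inf F (Inf C) \<le> x" "x \<le> F" if "x \<in> C" for x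
        using that by (auto intro: Inf_lower simp: Chains_def)
    qed
  qed
  then obtain U where U: "U \<in> Field ?R" "\<forall>a\<in>Field ?R. (U, a) \<in> ?R \<longrightarrow> a = U" ..
  then have "is_ultrafilter U"
    by (auto intro!: maximal_filter_is_ultrafilter)
  with U show ?thesis
    by auto
qed

lemma ultrafilter_of_directed:
  fixes \<A> :: "'a set set"
  assumes ne: "\<A> \<noteq> {}"
    and nonempty: "\<And>A. A \<in> \<A> \<Longrightarrow> A \<noteq> {}"
    and directed: "\<And>A B. A \<in> \<A> \<Longrightarrow> B \<in> \<A> \<Longrightarrow> \<exists>C\<in>\<A>. C \<subseteq> A \<inter> B"
  shows "\<exists>U. is_ultrafilter U \<and> (\<forall>A\<in>\<A>. eventually (\<lambda>j. j \<in> A) U)"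
proof -
  define F where "F = (INF A\<in>\<A>. principal A)"
  have "F \<noteq> bot"
  proof
    assume "F = bot"
    then have "eventually (\<lambda>_. False) F" by simp
    moreover have "\<exists>C\<in>\<A>. principal C \<le> inf (principal A) (principal B)"
      if "A \<in> \<A>" "B \<in> \<A>" for A B
      using directed[OF that] by simp
    ultimately obtain A where "A \<in> \<A>" "eventually (\<lambda>_. False) (principal A)"
      unfolding F_def using eventually_INF_base[OF ne] by blast
    then show False using nonempty by (auto simp: eventually_principal)
  qed
  then obtain U where "U \<le> F" "is_ultrafilter U"
    using ultrafilter_exists_le by blast
  moreover have "eventually (\<lambda>j. j \<in> A) F" if "A \<in> \<A>" for A
    unfolding F_def using that by (intro eventually_INF1) (auto simp: eventually_principal)
  ultimately show ?thesis
    using filter_leD by blast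
qed

lemma ultrafilter_tendsto_compact:
  fixes h :: "'a \<Rightarrow> 'b::topological_space"
  assumes U: "is_ultrafilter U" and K: "compact K" and ev: "eventually (\<lambda>j. h j \<in> K) U"
  shows "\<exists>L. (h \<longlongrightarrow> L) U"
proof -
  have "filtermap h U \<noteq> bot"
    using U by (simp add: is_ultrafilter_def filtermap_bot_iff)
  moreover have "eventually (\<lambda>y. y \<in> K) (filtermap h U)"
    using ev by (simp add: eventually_filtermap)
  ultimately obtain L where L: "inf (nhds L) (filtermap h U) \<noteq> bot"
    using K by (auto simp: compact_filter)
  have "(h \<longlongrightarrow> L) U"
    unfolding tendsto_def
  proof (intro allI impI)
    fix S assume S: "open S" "L \<in> S"
    show "eventually (\<lambda>j. h j \<in> S) U"
    proof (rule ccontr)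
      assume "\<not> eventually (\<lambda>j. h j \<in> S) U"
      then have "eventually (\<lambda>y. y \<notin> S) (filtermap h U)"
        using U by (auto simp: is_ultrafilter_def eventually_filtermap)
      moreover have "eventually (\<lambda>y. y \<in> S) (nhds L)"
        using S eventually_nhds by blast
      ultimately have "eventually (\<lambda>_. False) (inf (nhds L) (filtermap h U))"
        unfolding eventually_inf by blast
      then show False using L by (simp add: trivial_limit_def)
    qed
  qed
  then show ?thesis by blast
qed

section \<open>Complemented embeddings from retractions\<close>

lemma comp_embeds_of_retraction:
  fixes T :: "'v::real_vector \<Rightarrow> 'w::real_vector" and S :: "'w \<Rightarrow> 'v"
  assumes X0: "0 \<in> X"
    and Xadd: "\<And>x y. x \<in> X \<Longrightarrow> y \<in> X \<Longrightarrow> x + y \<in> X"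
    and Xscale: "\<And>c x. x \<in> X \<Longrightarrow> c *\<^sub>R x \<in> X"
    and T: "bdd_lin_op X NX Y NY T" and Tb: "\<And>x. x \<in> X \<Longrightarrow> NY (T x) \<le> NX x"
    and S: "bdd_lin_op Y NY X NX S" and Sb: "\<And>y. y \<in> Y \<Longrightarrow> NX (S y) \<le> NY y"
    and ST: "\<And>x. x \<in> X \<Longrightarrow> S (T x) = x"
  shows "comp_embeds X NX Y NY"
proof -
  define Z where "Z = T ` X"
  have TY: "\<And>x. x \<in> X \<Longrightarrow> T x \<in> Y"
    and Tadd: "\<And>x x'. x \<in> X \<Longrightarrow> x' \<in> X \<Longrightarrow> T (x + x') = T x + T x'"
    and Tscale: "\<And>c x. x \<in> X \<Longrightarrow> T (c *\<^sub>R x) = c *\<^sub>R T x"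
    using T by (auto simp: bdd_lin_op_def)
  have SX: "\<And>y. y \<in> Y \<Longrightarrow> S y \<in> X"
    and Sadd: "\<And>y y'. y \<in> Y \<Longrightarrow> y' \<in> Y \<Longrightarrow> S (y + y') = S y + S y'"
    and Sscale: "\<And>c y. y \<in> Y \<Longrightarrow> S (c *\<^sub>R y) = c *\<^sub>R S y"
    using S by (auto simp: bdd_lin_op_def)
  have injT: "inj_on T X"
    by (metis ST inj_on_inverseI)
  have inv_T: "inv_into X T z = S z" if "z \<in> Z" for z
    using that injT ST unfolding Z_def by auto
  have "lin_subspace Z Y"
    unfolding lin_subspace_def Z_def
  proof (intro conjI ballI allI)
    show "T ` X \<subseteq> Y" using TY by auto
    show "0 \<in> T ` X" using X0 Tscale[OF X0, of 0] by (metis image_eqI scale_zero_left)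
  next
    fix z z' assume "z \<in> T ` X" "z' \<in> T ` X"
    then obtain x x' where "x \<in> X" "x' \<in> X" "z = T x" "z' = T x'" by blast
    then show "z + z' \<in> T ` X" using Tadd Xadd by (metis image_eqI)
  next
    fix c z assume "z \<in> T ` X"
    then obtain x where "x \<in> X" "z = T x" by blast
    then show "c *\<^sub>R z \<in> T ` X" using Tscale Xscale by (metis image_eqI)
  qed
  moreover have "bdd_lin_op Y NY Y NY (\<lambda>y. T (S y))"
    unfolding bdd_lin_op_def
    using TY SX Tadd Sadd Tscale Sscale X0
    by (auto intro!: exI[of _ 1] order_trans[OF Tb Sb])
  moreover have "(\<lambda>y. T (S y)) ` Y = Z" "\<forall>z\<in>Z. T (S z) = z"
    unfolding Z_def using SX ST TY by force+
  ultimately have "complemented Z Y NY"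
    unfolding complemented_def by blast
  moreover have "isomorphic X NX Z NY"
    unfolding isomorphic_def
  proof (intro exI conjI)
    show "bij_betw T X Z" using injT Z_def by (simp add: bij_betw_def)
    show "bdd_lin_op X NX Z NY T"
      unfolding bdd_lin_op_def Z_def using Tadd Tscale Tb X0 by (auto intro!: exI[of _ 1])
    show "bdd_lin_op Z NY X NX (inv_into X T)"
      unfolding bdd_lin_op_def
      using inv_T SX Sadd Sscale Sb \<open>lin_subspace Z Y\<close>
      by (auto simp: lin_subspace_def subset_iff intro!: exI[of _ 1])
  qed
  ultimately show ?thesis
    unfolding comp_embeds_def by blast
qed

section \<open>The spaces \<open>C(K)\<close>, \<open>c\<^sub>0\<close>, \<open>Lip\<^sub>0\<close> and \<open>\<ell>\<^sub>\<infinity>\<close>-sums\<close>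

lemma zero_in_CK: "(0 :: 'a::topological_space \<Rightarrow> real) \<in> CK"
  by (simp add: CK_def zero_fun_def)

lemma diff_in_CK:
  fixes x y :: "'a::topological_space \<Rightarrow> real"
  shows "x \<in> CK \<Longrightarrow> y \<in> CK \<Longrightarrow> x - y \<in> CK"
  unfolding CK_def by (auto simp: fun_diff_def intro!: continuous_intros)

lemma abs_le_CK_norm:
  assumes cpt: "compact (UNIV :: 'a::topological_space set)" and x: "x \<in> (CK :: ('a \<Rightarrow> real) set)"
  shows "\<bar>x t\<bar> \<le> CK_norm x"
proof -
  have "compact (range x)"
    using x cpt unfolding CK_def by (auto intro: compact_continuous_image)
  then obtain M where "\<And>t. \<bar>x t\<bar> \<le> M"
    by (metis compact_imp_bounded bounded_real rangeI)
  then have "bdd_above (range (\<lambda>t. \<bar>x t\<bar>))"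
    by (rule bdd_aboveI2)
  then show ?thesis
    unfolding CK_norm_def by (rule cSUP_upper[OF UNIV_I])
qed

lemma CK_norm_le:
  assumes "\<And>t. \<bar>(x :: 'a::topological_space \<Rightarrow> real) t\<bar> \<le> M"
  shows "CK_norm x \<le> M"
  unfolding CK_norm_def using assms by (intro cSUP_least) auto

lemma CK_norm_nonneg:
  assumes "compact (UNIV :: 'a::topological_space set)" and "x \<in> (CK :: ('a \<Rightarrow> real) set)"
  shows "0 \<le> CK_norm x"
  using abs_le_CK_norm[OF assms, of undefined] by linarith

lemma zero_in_c0: "(0 :: nat \<Rightarrow> real) \<in> c0"
  by (simp add: c0_def zero_fun_def)

lemma diff_in_c0: "x \<in> c0 \<Longrightarrow> y \<in> c0 \<Longrightarrow> x - y \<in> c0"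
  unfolding c0_def using tendsto_diff by (fastforce simp: fun_diff_def)

lemma abs_le_c0_norm:
  assumes "x \<in> c0"
  shows "\<bar>x n\<bar> \<le> c0_norm x"
proof -
  have "bounded (range x)"
    using assms unfolding c0_def by (auto intro: convergent_imp_bounded)
  then obtain M where "\<And>n. \<bar>x n\<bar> \<le> M"
    by (auto simp: bounded_real)
  then have "bdd_above (range (\<lambda>n. \<bar>x n\<bar>))"
    by (rule bdd_aboveI2)
  then show ?thesis
    unfolding c0_norm_def by (rule cSUP_upper[OF UNIV_I])
qed

lemma c0_norm_le:
  assumes "\<And>n. \<bar>x n\<bar> \<le> M"
  shows "c0_norm x \<le> M"
  unfolding c0_norm_def using assms by (intro cSUP_least) auto

lemma c0_norm_nonneg:
  assumes "x \<in> c0"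
  shows "0 \<le> c0_norm x"
  using abs_le_c0_norm[OF assms, of 0] by linarith

lemma c0_norm_diff_nonneg: "x \<in> c0 \<Longrightarrow> y \<in> c0 \<Longrightarrow> 0 \<le> c0_norm (x - y)"
  using c0_norm_nonneg diff_in_c0 by blast

lemma Lip0_lipschitz_nonneg_const:
  assumes "f \<in> Lip0 V N" and N: "\<And>x y. x \<in> V \<Longrightarrow> y \<in> V \<Longrightarrow> 0 \<le> N (x - y)"
  shows "\<exists>C\<ge>0. \<forall>x\<in>V. \<forall>y\<in>V. \<bar>f x - f y\<bar> \<le> C * N (x - y)"
proof -
  obtain C where C: "\<forall>x\<in>V. \<forall>y\<in>V. \<bar>f x - f y\<bar> \<le> C * N (x - y)"
    using assms(1) by (auto simp: Lip0_def)
  have "\<bar>f x - f y\<bar> \<le> max C 0 * N (x - y)" if "x \<in> V" "y \<in> V" for x y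
    using C that mult_right_mono[OF max.cobounded1 N[OF that]] by (meson order_trans)
  then show ?thesis
    by (intro exI[of _ "max C 0"]) auto
qed

lemma Lip0_norm_nonneg:
  assumes "f \<in> Lip0 V N" and "\<And>x y. x \<in> V \<Longrightarrow> y \<in> V \<Longrightarrow> 0 \<le> N (x - y)"
  shows "0 \<le> Lip0_norm V N f"
  unfolding Lip0_norm_def using Lip0_lipschitz_nonneg_const[OF assms]
  by (intro cInf_greatest) auto

lemma Lip0_norm_le:
  assumes "0 \<le> C" "\<And>x y. x \<in> V \<Longrightarrow> y \<in> V \<Longrightarrow> \<bar>f x - f y\<bar> \<le> C * N (x - y)"
  shows "Lip0_norm V N f \<le> C"
  unfolding Lip0_norm_def using assms
  by (intro cInf_lower) (auto intro!: bdd_belowI[of _ 0])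

lemma Lip0_norm_lipschitz:
  assumes f: "f \<in> Lip0 V N" and N: "\<And>x y. x \<in> V \<Longrightarrow> y \<in> V \<Longrightarrow> 0 \<le> N (x - y)"
    and xy: "x \<in> V" "y \<in> V"
  shows "\<bar>f x - f y\<bar> \<le> Lip0_norm V N f * N (x - y)"
proof -
  let ?S = "{C. 0 \<le> C \<and> (\<forall>x\<in>V. \<forall>y\<in>V. \<bar>f x - f y\<bar> \<le> C * N (x - y))}"
  obtain C where C: "C \<in> ?S"
    using Lip0_lipschitz_nonneg_const[OF f N] by auto
  show ?thesis
  proof (cases "N (x - y) = 0")
    case True
    then show ?thesis using C xy by force
  next
    case False
    then have pos: "0 < N (x - y)" using N[OF xy] by auto
    have "\<bar>f x - f y\<bar> / N (x - y) \<le> Inf ?S"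
      using C xy pos by (intro cInf_greatest) (auto simp: divide_le_eq)
    then show ?thesis
      using pos unfolding Lip0_norm_def by (simp add: divide_le_eq)
  qed
qed

lemma Lip0_add:
  assumes f: "f \<in> Lip0 V N" and g: "g \<in> Lip0 V N"
    and N: "\<And>x y. x \<in> V \<Longrightarrow> y \<in> V \<Longrightarrow> 0 \<le> N (x - y)"
  shows "f + g \<in> Lip0 V N"
proof -
  have "\<bar>(f + g) x - (f + g) y\<bar> \<le> (Lip0_norm V N f + Lip0_norm V N g) * N (x - y)"
    if "x \<in> V" "y \<in> V" for x y
    using Lip0_norm_lipschitz[OF f N that] Lip0_norm_lipschitz[OF g N that]
    by (simp add: plus_fun_def distrib_right)
  then show ?thesis
    using f g unfolding Lip0_def by (auto simp: plus_fun_def)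
qed

lemma Lip0_scaleR:
  assumes f: "f \<in> Lip0 V N" and N: "\<And>x y. x \<in> V \<Longrightarrow> y \<in> V \<Longrightarrow> 0 \<le> N (x - y)"
  shows "c *\<^sub>R f \<in> Lip0 V N"
proof -
  have "\<bar>(c *\<^sub>R f) x - (c *\<^sub>R f) y\<bar> \<le> (\<bar>c\<bar> * Lip0_norm V N f) * N (x - y)"
    if "x \<in> V" "y \<in> V" for x y
  proof -
    have "\<bar>(c *\<^sub>R f) x - (c *\<^sub>R f) y\<bar> = \<bar>c\<bar> * \<bar>f x - f y\<bar>"
      by (simp add: scaleR_fun_def abs_mult[symmetric] right_diff_distrib)
    also have "\<dots> \<le> \<bar>c\<bar> * (Lip0_norm V N f * N (x - y))"
      using Lip0_norm_lipschitz[OF f N that] by (simp add: mult_left_mono)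
    finally show ?thesis by (simp add: mult.assoc)
  qed
  then show ?thesis
    using f unfolding Lip0_def by (auto simp: scaleR_fun_def)
qed

lemma zero_in_Lip0: "0 \<in> Lip0 V N"
  unfolding Lip0_def by (auto simp: zero_fun_def intro!: exI[of _ 0])

lemma linf_sum_component:
  assumes "z \<in> linf_sum \<Gamma> V N" "j \<in> \<Gamma>"
  shows "z j \<in> V" "N (z j) \<le> linf_norm \<Gamma> N z"
  using assms unfolding linf_sum_def linf_norm_def by (auto intro!: cSUP_upper)

lemma linf_norm_nonneg:
  assumes "z \<in> linf_sum \<Gamma> V N" "\<Gamma> \<noteq> {}" "\<And>v. v \<in> V \<Longrightarrow> 0 \<le> N v"
  shows "0 \<le> linf_norm \<Gamma> N z"
proof -
  obtain j where "j \<in> \<Gamma>" using assms(2) by auto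
  then show ?thesis
    using linf_sum_component[OF assms(1)] assms(3) by (meson order_trans)
qed

section \<open>Clopen partitions, sampling and step functions\<close>

definition clopen_partition :: "'a::topological_space set list \<Rightarrow> bool" where
  "clopen_partition p \<longleftrightarrow> distinct p \<and> (\<forall>A\<in>set p. open A \<and> closed A \<and> A \<noteq> {}) \<and>
     (\<forall>A\<in>set p. \<forall>B\<in>set p. A \<noteq> B \<longrightarrow> A \<inter> B = {}) \<and> \<Union>(set p) = UNIV"

definition partition_point :: "'a set list \<Rightarrow> nat \<Rightarrow> 'a" where
  "partition_point p k = (SOME t. t \<in> p!k)"

definition sample :: "'a set list \<Rightarrow> ('a \<Rightarrow> real) \<Rightarrow> nat \<Rightarrow> real" where
  "sample p x = (\<lambda>k. if k < length p then x (partition_point p k) else 0)"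

definition step_fun :: "'a set list \<Rightarrow> (nat \<Rightarrow> real) \<Rightarrow> 'a \<Rightarrow> real" where
  "step_fun p a = (\<lambda>t. \<Sum>k<length p. a k * indicator (p!k) t)"

lemma clopen_partition_nth:
  assumes "clopen_partition p" "k < length p"
  shows "open (p!k)" "closed (p!k)" "p!k \<noteq> {}"
  using assms by (auto simp: clopen_partition_def)

lemma clopen_partition_cover:
  assumes "clopen_partition p"
  obtains k where "k < length p" "t \<in> p!k"
proof -
  have "t \<in> \<Union>(set p)" using assms by (auto simp: clopen_partition_def)
  then show ?thesis using that by (auto simp: in_set_conv_nth)
qed

lemma clopen_partition_disjoint:
  assumes "clopen_partition p" "k < length p" "l < length p" "k \<noteq> l"
  shows "p!k \<inter> p!l = {}"
proof -
  have "p!k \<noteq> p!l" using assms by (auto simp: clopen_partition_def nth_eq_iff_index_eq)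
  then show ?thesis using assms by (auto simp: clopen_partition_def)
qed

lemma partition_point_in:
  assumes "clopen_partition p" "k < length p"
  shows "partition_point p k \<in> p!k"
  using clopen_partition_nth(3)[OF assms] unfolding partition_point_def by (auto intro: someI_ex)

lemma step_fun_eval:
  assumes p: "clopen_partition p" and k: "k < length p" "t \<in> p!k"
  shows "step_fun p a t = a k"
proof -
  have "t \<notin> p!l" if "l < length p" "l \<noteq> k" for l
    using clopen_partition_disjoint[OF p that(1) k(1) that(2)] k(2) by auto
  then have "step_fun p a t = (\<Sum>l\<in>{k}. a l * indicator (p!l) t)"
    unfolding step_fun_def using k(1) by (intro sum.mono_neutral_right) auto
  then show ?thesis using k(2) by simp
qed

lemma step_fun_in_CK:
  assumes "clopen_partition (p :: 'a::t2_space set list)"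
  shows "step_fun p a \<in> CK"
  unfolding CK_def step_fun_def
proof (intro CollectI continuous_on_sum continuous_on_mult continuous_on_const)
  fix k assume "k \<in> {..<length p}"
  then have "frontier (p!k) = {}"
    using clopen_partition_nth[OF assms] by (simp add: frontier_def interior_open closure_closed)
  then show "continuous_on UNIV (indicator (p!k) :: 'a \<Rightarrow> real)"
    by (intro continuous_at_imp_continuous_on) (auto simp: isCont_indicator)
qed

lemma step_fun_diff: "step_fun p (a - b) = step_fun p a - step_fun p b"
  unfolding step_fun_def fun_diff_def by (simp add: left_diff_distrib sum_subtractf)

lemma step_fun_zero: "step_fun p 0 = 0"
  unfolding step_fun_def zero_fun_def by simp

lemma CK_norm_step_fun_le:
  assumes p: "clopen_partition p" and a: "a \<in> c0"
  shows "CK_norm (step_fun p a) \<le> c0_norm a"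
proof (rule CK_norm_le)
  fix t
  obtain k where "k < length p" "t \<in> p!k" using clopen_partition_cover[OF p] .
  then show "\<bar>step_fun p a t\<bar> \<le> c0_norm a"
    using step_fun_eval[OF p] abs_le_c0_norm[OF a] by simp
qed

lemma sample_in_c0: "sample p x \<in> c0"
proof -
  have "eventually (\<lambda>k. sample p x k = 0) sequentially"
    unfolding eventually_sequentially sample_def by (intro exI[of _ "length p"]) auto
  then show ?thesis
    unfolding c0_def by (simp add: tendsto_eventually)
qed

lemma sample_diff: "sample p (x - y) = sample p x - sample p y"
  by (auto simp: sample_def fun_eq_iff fun_diff_def)

lemma sample_zero: "sample p 0 = 0"
  by (auto simp: sample_def fun_eq_iff zero_fun_def)

lemma c0_norm_sample_le:
  assumes "compact (UNIV :: 'a::topological_space set)" and "x \<in> (CK :: ('a \<Rightarrow> real) set)"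
  shows "c0_norm (sample p x) \<le> CK_norm x"
  by (rule c0_norm_le) (auto simp: sample_def abs_le_CK_norm[OF assms] CK_norm_nonneg[OF assms])

lemma dim_le_0_clopen_nbhd:
  fixes W :: "'a::topological_space set"
  assumes "(euclidean :: 'a topology) dim_le 0" "open W" "s \<in> W"
  obtains V where "closed V" "open V" "s \<in> V" "V \<subseteq> W"
proof -
  have "neighbourhood_base_of (\<lambda>U. closedin (euclidean :: 'a topology) U \<and> openin euclidean U) euclidean"
    using assms(1) dimension_le_0_neighbourhood_base_of_clopen by blast
  then show ?thesis
    using assms(2,3) that unfolding neighbourhood_base_of
    by (metis closed_closedin open_openin subsetD)
qed

lemma disjoint_clopen_refinement:
  fixes L :: "'a::topological_space set list"
  assumes "\<forall>V\<in>set L. open V \<and> closed V"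
  shows "\<exists>p. distinct p \<and> (\<forall>A\<in>set p. open A \<and> closed A \<and> A \<noteq> {} \<and> (\<exists>V\<in>set L. A \<subseteq> V)) \<and>
     (\<forall>A\<in>set p. \<forall>B\<in>set p. A \<noteq> B \<longrightarrow> A \<inter> B = {}) \<and> \<Union>(set p) = \<Union>(set L)"
  using assms
proof (induction L)
  case Nil
  then show ?case by (intro exI[of _ "[]"]) auto
next
  case (Cons V L)
  then obtain p where p: "distinct p" "\<forall>A\<in>set p. open A \<and> closed A \<and> A \<noteq> {} \<and> (\<exists>V\<in>set L. A \<subseteq> V)"
     "\<forall>A\<in>set p. \<forall>B\<in>set p. A \<noteq> B \<longrightarrow> A \<inter> B = {}" "\<Union>(set p) = \<Union>(set L)" by auto
  define N where "N = V - \<Union>(set L)"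
  have "open N" "closed N"
    using Cons.prems unfolding N_def by (auto intro!: open_Diff closed_Diff open_Union closed_Union)
  have disj: "N \<inter> A = {}" if "A \<in> set p" for A
    using that p(4) unfolding N_def by auto
  show ?case
  proof (cases "N = {}")
    case True
    then show ?thesis using p unfolding N_def by (intro exI[of _ p]) auto
  next
    case False
    then have "N \<notin> set p" using disj by auto
    then show ?thesis
      using p disj False \<open>open N\<close> \<open>closed N\<close>
      by (intro exI[of _ "N # p"]) (auto simp: N_def Int_commute)
  qed
qed

lemma clopen_partition_subordinate:
  fixes W :: "'a::topological_space \<Rightarrow> 'a set"
  assumes cpt: "compact (UNIV :: 'a set)" and dim: "(euclidean :: 'a topology) dim_le 0"
    and W: "\<And>s. open (W s)" "\<And>s. s \<in> W s"
  shows "\<exists>p. clopen_partition p \<and> (\<forall>A\<in>set p. \<exists>s. A \<subseteq> W s)"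
proof -
  have "\<forall>s. \<exists>V. closed V \<and> open V \<and> s \<in> V \<and> V \<subseteq> W s"
    using dim_le_0_clopen_nbhd[OF dim W] by metis
  then obtain V where V: "\<And>s. closed (V s) \<and> open (V s) \<and> s \<in> V s \<and> V s \<subseteq> W s"
    by metis
  have "\<And>s. s \<in> UNIV \<Longrightarrow> open (V s)" "UNIV \<subseteq> (\<Union>s\<in>UNIV. V s)"
    using V by blast+
  then obtain D where D: "D \<subseteq> UNIV" "finite D" "UNIV \<subseteq> (\<Union>s\<in>D. V s)"
    by (rule compactE_image[OF cpt])
  from finite_list[OF finite_imageI[OF D(2)], of V] obtain L where L: "set L = V ` D" ..
  have L_clopen: "\<forall>A\<in>set L. open A \<and> closed A"
    unfolding L using V by auto
  obtain p where p: "distinct p" "\<forall>A\<in>set p. open A \<and> closed A \<and> A \<noteq> {} \<and> (\<exists>V\<in>set L. A \<subseteq> V)"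
     "\<forall>A\<in>set p. \<forall>B\<in>set p. A \<noteq> B \<longrightarrow> A \<inter> B = {}" "\<Union>(set p) = \<Union>(set L)"
    using disjoint_clopen_refinement[OF L_clopen] by (elim exE conjE) (rule that)
  have "\<Union>(set L) = UNIV"
    using L D(3) by auto
  with p have "clopen_partition p"
    unfolding clopen_partition_def by simp
  moreover have "\<exists>s. A \<subseteq> W s" if A: "A \<in> set p" for A
  proof -
    obtain s where "A \<subseteq> V s" using p(2) A unfolding L by blast
    then show ?thesis using V by blast
  qed
  ultimately show ?thesis by blast
qed

lemma clopen_partition_approx:
  fixes F :: "('a::topological_space \<Rightarrow> real) set"
  assumes cpt: "compact (UNIV :: 'a set)" and dim: "(euclidean :: 'a topology) dim_le 0"
    and F: "finite F" "F \<subseteq> CK" and e: "0 < e"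
  shows "\<exists>p. clopen_partition p \<and> (\<forall>x\<in>F. CK_norm (step_fun p (sample p x) - x) \<le> e)"
proof -
  define W where "W s = (\<Inter>x\<in>F. {t. \<bar>x t - x s\<bar> < e/2})" for s
  have "open (W s)" for s
    unfolding W_def using F
    by (intro open_INT) (auto simp: CK_def intro!: open_Collect_less continuous_intros)
  moreover have "s \<in> W s" for s
    using e unfolding W_def by auto
  ultimately obtain p where p: "clopen_partition p" and sub: "\<forall>A\<in>set p. \<exists>s. A \<subseteq> W s"
    using clopen_partition_subordinate[OF cpt dim] by blast
  have "CK_norm (step_fun p (sample p x) - x) \<le> e" if x: "x \<in> F" for x
  proof (rule CK_norm_le)
    fix t
    obtain k where k: "k < length p" "t \<in> p!k" using clopen_partition_cover[OF p] .
    then obtain s where "p!k \<subseteq> W s" using sub nth_mem by blast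
    then have "\<bar>x t - x s\<bar> < e/2" "\<bar>x (partition_point p k) - x s\<bar> < e/2"
      using k partition_point_in[OF p k(1)] x unfolding W_def by auto
    moreover have "(step_fun p (sample p x) - x) t = x (partition_point p k) - x t"
      using step_fun_eval[OF p k] k by (simp add: sample_def fun_diff_def)
    ultimately show "\<bar>(step_fun p (sample p x) - x) t\<bar> \<le> e"
      by arith
  qed
  with p show ?thesis by blast
qed

section \<open>Counting clopen partitions\<close>

lemma times_self_lepoll:
  assumes "infinite A"
  shows "A \<times> A \<lesssim> A"
proof (rule eqpoll_imp_lepoll)
  show "A \<times> A \<approx> A"
    using card_of_Times_same_infinite[OF assms] by (simp add: eqpoll_iff_card_of_ordIso)
qed

text \<open>A list is encoded by its length together with the iterated pairing of its entries.\<close>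

lemma lists_lepoll_infinite:
  assumes inf: "infinite A"
  shows "lists A \<lesssim> A"
proof -
  obtain pair where pair: "inj_on pair (A \<times> A)" "pair ` (A \<times> A) \<subseteq> A"
    using times_self_lepoll[OF inf] unfolding lepoll_def by blast
  obtain a0 where a0: "a0 \<in> A"
    using inf by (metis finite.emptyI ex_in_conv)
  define enc where "enc l = foldr (\<lambda>x acc. pair (x, acc)) l a0" for l
  have enc_in: "enc l \<in> A" if "l \<in> lists A" for l
    using that a0 pair(2) by (induction l) (auto simp: enc_def)
  have enc_inj: "l = m" if "l \<in> lists A" "m \<in> lists A" "length l = length m" "enc l = enc m" for l m
    using that
  proof (induction l arbitrary: m rule: list.induct)
    case (Cons x l)
    then obtain y m' where m: "m = y # m'" by (cases m) auto
    have "pair (x, enc l) = pair (y, enc m')"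
      using Cons.prems(4) m by (simp add: enc_def)
    moreover have "(x, enc l) \<in> A \<times> A" "(y, enc m') \<in> A \<times> A"
      using Cons.prems(1,2) m enc_in by auto
    ultimately have "x = y" "enc l = enc m'"
      using inj_onD[OF pair(1)] by blast+
    then show ?case using Cons m by auto
  qed simp
  have "lists A \<lesssim> (UNIV :: nat set) \<times> A"
    unfolding lepoll_def
    using enc_in enc_inj by (intro exI[of _ "\<lambda>l. (length l, enc l)"]) (auto simp: inj_on_def)
  also have "(UNIV :: nat set) \<times> A \<lesssim> A \<times> A"
    using inf by (intro times_lepoll_mono) (auto simp: infinite_le_lepoll)
  also have "A \<times> A \<lesssim> A"
    by (rule times_self_lepoll[OF inf])
  finally show ?thesis .
qed

lemma topological_basis_infinite:
  assumes B: "topological_basis (B :: 'a::t1_space set set)" and inf: "infinite (UNIV :: 'a set)"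
  shows "infinite B"
proof
  assume "finite B"
  moreover have "{S::'a set. open S} \<subseteq> Union ` Pow B"
    using B unfolding topological_basis_def by blast
  ultimately have "finite {S::'a set. open S}"
    by (auto intro: finite_subset)
  moreover have "range (\<lambda>a::'a. - {a}) \<subseteq> {S. open S}"
    by auto
  ultimately have "finite (range (\<lambda>a::'a. - {a}))"
    using finite_subset by blast
  moreover have "inj (\<lambda>a::'a. - {a})"
    by (auto simp: inj_def)
  ultimately show False
    using inf
    by (simp add: finite_image_iff)
qed

lemma clopen_in_finite_unions:
  fixes A :: "'a::topological_space set"
  assumes cpt: "compact (UNIV :: 'a set)" and B: "topological_basis B"
    and A: "open A" "closed A"
  shows "A \<in> (\<lambda>l. \<Union>(set l)) ` lists B"
proof -
  obtain B' where B': "B' \<subseteq> B" "\<Union>B' = A"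
    using B A(1) unfolding topological_basis_def by auto
  have "compact A"
    using compact_Int_closed[OF cpt A(2)] by simp
  moreover have "\<And>b. b \<in> B' \<Longrightarrow> open b"
    using B' B by (auto simp: topological_basis_def)
  moreover have "A \<subseteq> \<Union>B'"
    using B' by simp
  ultimately obtain B'' where B'': "B'' \<subseteq> B'" "finite B''" "A \<subseteq> \<Union>B''"
    by (meson compactE)
  obtain l where "set l = B''"
    using finite_list[OF B''(2)] by blast
  with B'' B' show ?thesis
    by (intro image_eqI[of _ _ l]) auto
qed

lemma clopen_partitions_lepoll_basis:
  fixes B :: "'a::topological_space set set"
  assumes cpt: "compact (UNIV :: 'a set)" and B: "topological_basis B" "infinite B"
  shows "{p :: 'a set list. clopen_partition p} \<lesssim> B"
proof -
  have "(UNIV :: nat set) \<lesssim> B"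
    using B(2) by (simp add: infinite_le_lepoll)
  also have "B \<lesssim> lists B"
    by (rule lepoll_lists)
  finally have "infinite (lists B)"
    by (simp add: infinite_le_lepoll)
  have "{p :: 'a set list. clopen_partition p} \<lesssim> lists {A :: 'a set. open A \<and> closed A}"
    by (rule subset_imp_lepoll) (auto simp: clopen_partition_def)
  also have "\<dots> \<lesssim> lists (lists B)"
  proof (rule lists_lepoll_mono)
    show "{A :: 'a set. open A \<and> closed A} \<lesssim> lists B"
      by (rule subset_image_lepoll) (auto intro: clopen_in_finite_unions[OF cpt B(1)])
  qed
  also have "\<dots> \<lesssim> lists B"
    by (rule lists_lepoll_infinite) fact
  also have "\<dots> \<lesssim> B"
    by (rule lists_lepoll_infinite) (rule B(2))
  finally show ?thesis .
qed

section \<open>The embedding and its retraction\<close>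

locale sampling_ultrafilter =
  fixes \<Gamma> :: "'i set" and part :: "'i \<Rightarrow> 'a::t2_space set list" and U :: "'i filter"
  assumes compact_UNIV: "compact (UNIV :: 'a set)"
    and part: "\<And>j. clopen_partition (part j)"
    and ultrafilter: "is_ultrafilter U"
    and eventually_in_\<Gamma>: "eventually (\<lambda>j. j \<in> \<Gamma>) U"
    and eventually_step_sample_close: "\<And>x e. x \<in> CK \<Longrightarrow> 0 < e \<Longrightarrow>
      eventually (\<lambda>j. CK_norm (step_fun (part j) (sample (part j) x) - x) \<le> e) U"
begin

abbreviation "LK \<equiv> Lip0 (CK :: ('a \<Rightarrow> real) set) CK_norm"
abbreviation "NLK \<equiv> Lip0_norm (CK :: ('a \<Rightarrow> real) set) CK_norm"
abbreviation "Lc0 \<equiv> Lip0 c0 c0_norm"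
abbreviation "NLc0 \<equiv> Lip0_norm c0 c0_norm"

definition embed :: "(('a \<Rightarrow> real) \<Rightarrow> real) \<Rightarrow> 'i \<Rightarrow> (nat \<Rightarrow> real) \<Rightarrow> real" where
  "embed f = (\<lambda>j. if j \<in> \<Gamma> then (\<lambda>a. if a \<in> c0 then f (step_fun (part j) a) else 0) else 0)"

definition retract :: "('i \<Rightarrow> (nat \<Rightarrow> real) \<Rightarrow> real) \<Rightarrow> ('a \<Rightarrow> real) \<Rightarrow> real" where
  "retract g = (\<lambda>x. if x \<in> CK then Lim U (\<lambda>j. g j (sample (part j) x)) else 0)"

lemma U_ne_bot: "U \<noteq> bot"
  using ultrafilter by (simp add: is_ultrafilter_def)

lemma \<Gamma>_ne: "\<Gamma> \<noteq> {}"
proof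
  assume "\<Gamma> = {}"
  then have "eventually (\<lambda>_. False) U"
    using eventually_in_\<Gamma> by simp
  then show False
    using U_ne_bot by (simp add: eventually_False)
qed

lemma CK_norm_diff_nonneg: "x \<in> CK \<Longrightarrow> y \<in> CK \<Longrightarrow> 0 \<le> CK_norm (x - (y :: 'a \<Rightarrow> real))"
  using CK_norm_nonneg[OF compact_UNIV] diff_in_CK by blast

lemma LK_lipschitz: "f \<in> LK \<Longrightarrow> x \<in> CK \<Longrightarrow> y \<in> CK \<Longrightarrow> \<bar>f x - f y\<bar> \<le> NLK f * CK_norm (x - y)"
  by (rule Lip0_norm_lipschitz) (auto intro: CK_norm_diff_nonneg)

lemma NLK_nonneg: "f \<in> LK \<Longrightarrow> 0 \<le> NLK f"
  by (rule Lip0_norm_nonneg) (auto intro: CK_norm_diff_nonneg)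

lemma comp_step_fun_Lip0:
  assumes f: "f \<in> LK" and p: "clopen_partition p"
  shows "(\<lambda>a. if a \<in> c0 then f (step_fun p a) else 0) \<in> Lc0" (is "?h \<in> _")
    and "NLc0 (\<lambda>a. if a \<in> c0 then f (step_fun p a) else 0) \<le> NLK f"
proof -
  have lip: "\<bar>?h a - ?h b\<bar> \<le> NLK f * c0_norm (a - b)" if ab: "a \<in> c0" "b \<in> c0" for a b
  proof -
    have "\<bar>?h a - ?h b\<bar> \<le> NLK f * CK_norm (step_fun p a - step_fun p b)"
      using ab LK_lipschitz[OF f] step_fun_in_CK[OF p] by simp
    also have "\<dots> \<le> NLK f * c0_norm (a - b)"
      unfolding step_fun_diff[symmetric]
      by (intro mult_left_mono CK_norm_step_fun_le p diff_in_c0 ab NLK_nonneg f)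
    finally show ?thesis .
  qed
  have "?h 0 = 0"
    using f zero_in_c0 by (simp add: step_fun_zero Lip0_def)
  with lip show "?h \<in> Lc0"
    unfolding Lip0_def by auto
  show "NLc0 ?h \<le> NLK f"
    using lip NLK_nonneg[OF f] by (intro Lip0_norm_le) auto
qed

lemma embed_mem: "f \<in> LK \<Longrightarrow> embed f \<in> linf_sum \<Gamma> Lc0 NLc0"
  unfolding linf_sum_def embed_def using comp_step_fun_Lip0[OF _ part]
  by (auto intro!: bdd_aboveI[where M="NLK f"])

lemma embed_norm_le: "f \<in> LK \<Longrightarrow> linf_norm \<Gamma> NLc0 (embed f) \<le> NLK f"
  unfolding linf_norm_def embed_def using comp_step_fun_Lip0[OF _ part] \<Gamma>_ne
  by (auto intro!: cSUP_least)

lemma embed_add: "embed (f + g) = embed f + embed g"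
  unfolding embed_def by (auto simp: fun_eq_iff plus_fun_def)

lemma embed_scaleR: "embed ((c :: real) *\<^sub>R f) = c *\<^sub>R embed f"
  unfolding embed_def by (auto simp: fun_eq_iff scaleR_fun_def)


lemma linf_sum_sample_lipschitz:
  assumes g: "g \<in> linf_sum \<Gamma> Lc0 NLc0" and j: "j \<in> \<Gamma>" and xy: "x \<in> CK" "y \<in> CK"
  shows "\<bar>g j (sample (part j) x) - g j (sample (part j) y)\<bar> \<le> linf_norm \<Gamma> NLc0 g * CK_norm (x - y)"
proof -
  note gj = linf_sum_component[OF g j]
  have "\<bar>g j (sample (part j) x) - g j (sample (part j) y)\<bar>
      \<le> NLc0 (g j) * c0_norm (sample (part j) (x - y))"
    unfolding sample_diff
    by (intro Lip0_norm_lipschitz gj(1) c0_norm_diff_nonneg sample_in_c0)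
  also have "\<dots> \<le> linf_norm \<Gamma> NLc0 g * CK_norm (x - y)"
    by (intro mult_mono gj(2) c0_norm_sample_le compact_UNIV diff_in_CK xy c0_norm_nonneg
        sample_in_c0 linf_norm_nonneg[OF g \<Gamma>_ne] Lip0_norm_nonneg c0_norm_diff_nonneg) auto
  finally show ?thesis .
qed

lemma linf_sum_sample_zero: "g \<in> linf_sum \<Gamma> Lc0 NLc0 \<Longrightarrow> j \<in> \<Gamma> \<Longrightarrow> g j (sample (part j) 0) = 0"
  using linf_sum_component(1) by (fastforce simp: sample_zero Lip0_def)

text \<open>The samples of a fixed \<open>x\<close> stay in a compact interval, so their ultrafilter limit exists.\<close>

lemma retract_tendsto:
  assumes g: "g \<in> linf_sum \<Gamma> Lc0 NLc0" and x: "x \<in> CK"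
  shows "((\<lambda>j. g j (sample (part j) x)) \<longlongrightarrow> retract g x) U"
proof -
  let ?M = "linf_norm \<Gamma> NLc0 g * CK_norm x"
  have bounded: "eventually (\<lambda>j. g j (sample (part j) x) \<in> {-?M..?M}) U"
    using eventually_in_\<Gamma>
  proof (rule eventually_mono)
    fix j assume j: "j \<in> \<Gamma>"
    show "g j (sample (part j) x) \<in> {-?M..?M}"
      using linf_sum_sample_lipschitz[OF g j x zero_in_CK] linf_sum_sample_zero[OF g j]
      by (simp add: abs_le_iff)
  qed
  then obtain L where L: "((\<lambda>j. g j (sample (part j) x)) \<longlongrightarrow> L) U"
    using ultrafilter_tendsto_compact[OF ultrafilter compact_Icc bounded] by blast
  moreover have "retract g x = L"
    unfolding retract_def using x tendsto_Lim[OF U_ne_bot L] by simp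
  ultimately show ?thesis by simp
qed

lemma retract_mem: "g \<in> linf_sum \<Gamma> Lc0 NLc0 \<Longrightarrow> retract g \<in> LK"
  and retract_norm_le: "g \<in> linf_sum \<Gamma> Lc0 NLc0 \<Longrightarrow> NLK (retract g) \<le> linf_norm \<Gamma> NLc0 g"
proof -
  assume g: "g \<in> linf_sum \<Gamma> Lc0 NLc0"
  have lip: "\<bar>retract g x - retract g y\<bar> \<le> linf_norm \<Gamma> NLc0 g * CK_norm (x - y)"
    if xy: "x \<in> CK" "y \<in> CK" for x y
  proof (rule tendsto_upperbound[OF _ _ U_ne_bot])
    show "((\<lambda>j. \<bar>g j (sample (part j) x) - g j (sample (part j) y)\<bar>)
        \<longlongrightarrow> \<bar>retract g x - retract g y\<bar>) U"
      by (intro tendsto_rabs tendsto_diff retract_tendsto g xy)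
    show "eventually (\<lambda>j. \<bar>g j (sample (part j) x) - g j (sample (part j) y)\<bar>
        \<le> linf_norm \<Gamma> NLc0 g * CK_norm (x - y)) U"
      using eventually_in_\<Gamma> by (rule eventually_mono) (rule linf_sum_sample_lipschitz[OF g _ xy])
  qed
  have "((\<lambda>j. g j (sample (part j) 0)) \<longlongrightarrow> 0) U"
    by (intro tendsto_eventually eventually_mono[OF eventually_in_\<Gamma>] linf_sum_sample_zero[OF g])
  then have "retract g 0 = 0"
    using tendsto_unique[OF U_ne_bot retract_tendsto[OF g zero_in_CK]] by blast
  with lip show "retract g \<in> LK"
    unfolding Lip0_def by (auto simp: retract_def)
  have "0 \<le> linf_norm \<Gamma> NLc0 g"
    using linf_norm_nonneg[OF g \<Gamma>_ne] Lip0_norm_nonneg c0_norm_diff_nonneg by blast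
  with lip show "NLK (retract g) \<le> linf_norm \<Gamma> NLc0 g"
    by (intro Lip0_norm_le) auto
qed

lemma retract_add:
  assumes g: "g \<in> linf_sum \<Gamma> Lc0 NLc0" and h: "h \<in> linf_sum \<Gamma> Lc0 NLc0"
  shows "retract (g + h) = retract g + retract h"
proof
  fix x
  show "retract (g + h) x = (retract g + retract h) x"
  proof (cases "x \<in> CK")
    case True
    have "((\<lambda>j. (g + h) j (sample (part j) x)) \<longlongrightarrow> retract g x + retract h x) U"
      using tendsto_add[OF retract_tendsto[OF g True] retract_tendsto[OF h True]]
      by (simp add: plus_fun_def)
    then have "Lim U (\<lambda>j. (g + h) j (sample (part j) x)) = retract g x + retract h x"
      by (rule tendsto_Lim[OF U_ne_bot])
    then show ?thesis
      using True by (simp add: retract_def[of "g + h"])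
  qed (simp add: retract_def plus_fun_def)
qed

lemma retract_scaleR:
  fixes c :: real
  assumes g: "g \<in> linf_sum \<Gamma> Lc0 NLc0"
  shows "retract (c *\<^sub>R g) = c *\<^sub>R retract g"
proof
  fix x
  show "retract (c *\<^sub>R g) x = (c *\<^sub>R retract g) x"
  proof (cases "x \<in> CK")
    case True
    have "((\<lambda>j. (c *\<^sub>R g) j (sample (part j) x)) \<longlongrightarrow> c * retract g x) U"
      using tendsto_mult_left[OF retract_tendsto[OF g True]] by (simp add: scaleR_fun_def)
    then have "Lim U (\<lambda>j. (c *\<^sub>R g) j (sample (part j) x)) = c * retract g x"
      by (rule tendsto_Lim[OF U_ne_bot])
    then show ?thesis
      unfolding retract_def[of "c *\<^sub>R g"] using True by (simp add: scaleR_fun_def)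
  qed (simp add: retract_def scaleR_fun_def)
qed

lemma step_sample_tendsto:
  assumes x: "x \<in> CK"
  shows "((\<lambda>j. CK_norm (step_fun (part j) (sample (part j) x) - x)) \<longlongrightarrow> 0) U"
  unfolding tendsto_iff
proof (intro allI impI)
  fix e :: real assume "0 < e"
  then have "eventually (\<lambda>j. CK_norm (step_fun (part j) (sample (part j) x) - x) \<le> e/2) U"
    by (intro eventually_step_sample_close x) simp
  then show "eventually (\<lambda>j. dist (CK_norm (step_fun (part j) (sample (part j) x) - x)) 0 < e) U"
    using \<open>0 < e\<close> CK_norm_diff_nonneg[OF step_fun_in_CK[OF part] x]
    by (auto elim!: eventually_mono)
qed

lemma retract_embed:
  assumes f: "f \<in> LK"
  shows "retract (embed f) = f"
proof
  fix x
  show "retract (embed f) x = f x"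
  proof (cases "x \<in> CK")
    case False
    then show ?thesis using f by (simp add: retract_def Lip0_def)
  next
    case x: True
    let ?y = "\<lambda>j. step_fun (part j) (sample (part j) x)"
    have "((\<lambda>j. f (?y j) - f x) \<longlongrightarrow> 0) U"
    proof (rule Lim_null_comparison)
      show "((\<lambda>j. NLK f * CK_norm (?y j - x)) \<longlongrightarrow> 0) U"
        using tendsto_mult_right_zero[OF step_sample_tendsto[OF x]] .
      show "eventually (\<lambda>j. norm (f (?y j) - f x) \<le> NLK f * CK_norm (?y j - x)) U"
        using LK_lipschitz[OF f step_fun_in_CK[OF part] x] by simp
    qed
    then have "((\<lambda>j. f (?y j)) \<longlongrightarrow> f x) U"
      by (rule LIM_zero_cancel)
    moreover have "eventually (\<lambda>j. f (?y j) = embed f j (sample (part j) x)) U"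
      using eventually_in_\<Gamma> by (rule eventually_mono) (simp add: embed_def sample_in_c0)
    ultimately have "((\<lambda>j. embed f j (sample (part j) x)) \<longlongrightarrow> f x) U"
      by (rule Lim_transform_eventually)
    then show ?thesis
      using x tendsto_Lim[OF U_ne_bot] by (simp add: retract_def)
  qed
qed

lemma comp_embeds_Lip0_CK:
  "comp_embeds LK NLK (linf_sum \<Gamma> Lc0 NLc0) (linf_norm \<Gamma> NLc0)"
proof (rule comp_embeds_of_retraction[where T = embed and S = retract])
  show "0 \<in> LK"
    by (rule zero_in_Lip0)
  show "f + g \<in> LK" if "f \<in> LK" "g \<in> LK" for f g
    by (intro Lip0_add that CK_norm_diff_nonneg)
  show "c *\<^sub>R f \<in> LK" if "f \<in> LK" for c f
    by (intro Lip0_scaleR that CK_norm_diff_nonneg)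
  show "bdd_lin_op LK NLK (linf_sum \<Gamma> Lc0 NLc0) (linf_norm \<Gamma> NLc0) embed"
    unfolding bdd_lin_op_def
    by (intro conjI ballI allI exI[of _ 1]) (simp_all add: embed_mem embed_add embed_scaleR embed_norm_le)
  show "bdd_lin_op (linf_sum \<Gamma> Lc0 NLc0) (linf_norm \<Gamma> NLc0) LK NLK retract"
    unfolding bdd_lin_op_def
    by (intro conjI ballI allI exI[of _ 1])
      (simp_all add: retract_mem retract_add retract_scaleR retract_norm_le)
qed (simp_all add: embed_norm_le retract_norm_le retract_embed)

end

lemma clopen_partitions_indexed:
  fixes \<Gamma> :: "'i set" and p0 :: "'a::topological_space set list"
  assumes "{p :: 'a set list. clopen_partition p} \<lesssim> \<Gamma>"
    and p0: "clopen_partition p0"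
  obtains part :: "'i \<Rightarrow> 'a set list"
  where "\<And>j. clopen_partition (part j)" "\<And>p. clopen_partition p \<Longrightarrow> \<exists>j\<in>\<Gamma>. part j = p"
proof -
  let ?P = "{p :: 'a set list. clopen_partition p}"
  obtain g where g: "inj_on g ?P" "g ` ?P \<subseteq> \<Gamma>"
    using assms(1) unfolding lepoll_def by blast
  define part where "part j = (if j \<in> g ` ?P then inv_into ?P g j else p0)" for j
  have "clopen_partition (part j)" for j
    using p0 inv_into_into[of j g ?P] by (auto simp: part_def)
  moreover have "\<exists>j\<in>\<Gamma>. part j = p" if "clopen_partition p" for p
    using that g by (intro bexI[of _ "g p"]) (auto simp: part_def)
  ultimately show ?thesis
    using that by blast
qed

text \<open>\<open>U\<close> refines the filter of the sets \<open>close X e\<close> of indices whose partition approximates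
  every \<open>x \<in> X\<close> within \<open>e\<close>; these sets are directed and nonempty because every finite
  family of continuous functions is approximated by some partition.\<close>

lemma sampling_ultrafilter_exists:
  fixes \<Gamma> :: "'i set" and part :: "'i \<Rightarrow> 'a::t2_space set list"
  assumes cpt: "compact (UNIV :: 'a set)" and dim: "(euclidean :: 'a topology) dim_le 0"
    and part: "\<And>j. clopen_partition (part j)"
    and onto: "\<And>p. clopen_partition p \<Longrightarrow> \<exists>j\<in>\<Gamma>. part j = p"
  shows "\<exists>U. sampling_ultrafilter \<Gamma> part U"
proof -
  define close where "close X e =
    {j\<in>\<Gamma>. \<forall>x\<in>X. CK_norm (step_fun (part j) (sample (part j) x) - x) \<le> e}" for X e
  define \<A> where "\<A> = {close X e |X e. finite X \<and> X \<subseteq> CK \<and> 0 < e}"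
  have close_in: "close X e \<in> \<A>" if "finite X" "X \<subseteq> CK" "0 < e" for X e
    using that unfolding \<A>_def by blast
  have "\<exists>U. is_ultrafilter U \<and> (\<forall>A\<in>\<A>. eventually (\<lambda>j. j \<in> A) U)"
  proof (rule ultrafilter_of_directed)
    show "\<A> \<noteq> {}"
      using close_in[of "{}" 1] by auto
  next
    fix A assume "A \<in> \<A>"
    then obtain X e where A: "A = close X e" "finite X" "X \<subseteq> CK" "0 < e"
      unfolding \<A>_def by blast
    then obtain p where "clopen_partition p" "\<forall>x\<in>X. CK_norm (step_fun p (sample p x) - x) \<le> e"
      using clopen_partition_approx[OF cpt dim] by blast
    with onto show "A \<noteq> {}"
      unfolding A(1) close_def by blast
  next
    fix A B assume "A \<in> \<A>" "B \<in> \<A>"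
    then obtain X e Y d where "A = close X e" "B = close Y d" "finite X" "X \<subseteq> CK" "0 < e"
      "finite Y" "Y \<subseteq> CK" "0 < d"
      unfolding \<A>_def by blast
    then show "\<exists>C\<in>\<A>. C \<subseteq> A \<inter> B"
      by (intro bexI[OF _ close_in[of "X \<union> Y" "min e d"]]) (auto simp: close_def)
  qed
  then obtain U where U: "is_ultrafilter U" "\<And>A. A \<in> \<A> \<Longrightarrow> eventually (\<lambda>j. j \<in> A) U"
    by blast
  have "eventually (\<lambda>j. j \<in> \<Gamma>) U"
    using U(2)[OF close_in[of "{}" 1]] by (auto simp: close_def)
  moreover have "eventually (\<lambda>j. CK_norm (step_fun (part j) (sample (part j) x) - x) \<le> e) U"
    if "x \<in> CK" "0 < e" for x e
    using U(2)[OF close_in[of "{x}" e]] that by (auto simp: close_def elim!: eventually_mono)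
  ultimately have "sampling_ultrafilter \<Gamma> part U"
    unfolding sampling_ultrafilter_def using cpt part U(1) by blast
  then show ?thesis ..
qed

theorem mainTheorem13:
  fixes \<Gamma> :: "'i set"
  assumes "compact (UNIV :: 'a::t2_space set)"
    and "(euclidean :: 'a topology) dim_le 0"
    and "infinite (UNIV :: 'a set)"
    and "has_weight_card TYPE('a) \<Gamma>"
  shows "comp_embeds (Lip0 (CK :: ('a \<Rightarrow> real) set) CK_norm) (Lip0_norm (CK :: ('a \<Rightarrow> real) set) CK_norm)
           (linf_sum \<Gamma> (Lip0 c0 c0_norm) (Lip0_norm c0 c0_norm))
           (linf_norm \<Gamma> (Lip0_norm c0 c0_norm))"
proof -
  obtain B :: "'a set set" where B: "topological_basis B" "B \<approx> \<Gamma>"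
    using assms(4) unfolding has_weight_card_def by blast
  have "{p :: 'a set list. clopen_partition p} \<lesssim> B"
    using clopen_partitions_lepoll_basis[OF assms(1) B(1) topological_basis_infinite[OF B(1) assms(3)]] .
  also have "B \<lesssim> \<Gamma>"
    using B(2) by (rule eqpoll_imp_lepoll)
  finally have "{p :: 'a set list. clopen_partition p} \<lesssim> \<Gamma>" .
  moreover obtain p0 :: "'a set list" where "clopen_partition p0"
    using clopen_partition_approx[OF assms(1,2), of "{}" 1] by auto
  ultimately obtain part :: "'i \<Rightarrow> 'a set list" where
    "\<And>j. clopen_partition (part j)" "\<And>p. clopen_partition p \<Longrightarrow> \<exists>j\<in>\<Gamma>. part j = p"
    by (rule clopen_partitions_indexed) blast
  then obtain U where "sampling_ultrafilter \<Gamma> part U"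
    using sampling_ultrafilter_exists[OF assms(1,2)] by blast
  then show ?thesis
    by (rule sampling_ultrafilter.comp_embeds_Lip0_CK)
qed
end
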